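(* Let $X$ be a Banach space and let $Y$ be an almost isometric ideal ($ai$-ideal) in $X$. If $Y$ has $BDP$, then $X$ has $BDP$.
   Context: All Banach spaces are real and nontrivial ($\neq \{0\}$); $Y$ is a closed subspace of $X$. $B_X$ is the closed unit ball of $X$. A subspace $Y$ of $X$ is an almost isometric ideal ($ai$-ideal) in $X$ if for every $\varepsilon > 0$ and every finite dimensional subspace $E \subset X$ there exists a linear operator $T : E \to Y$ such that (1) $Te = e$ for all $e \in E \cap Y$, and (2) $\frac{1}{1+\varepsilon}\|e\| \leq \|Te\| \leq (1+\varepsilon)\|e\|$ for all $e \in E$. Slices: for $f \in X^*$ with $\|f\| = 1$ and $\alpha > 0$, the set $S(B_X,f,\alpha) = \{x \in B_X : f(x) > \sup f(B_X) - \alpha\}$ is an open slice of $B_X$. A Banach space $X$ has $BDP$ (ball dentable property) if for every $\varepsilon > 0$ there is a slice of $B_X$ with (norm) diameter less than $\varepsilon$. *)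

theory Defs
  imports "HOL-Analysis.Analysis"
begin

text \<open>A closed subspace of a Banach space is represented by its carrier set; the whole space is
  \<open>UNIV\<close>. Maps defined on a subspace are total functions of which only the values on the
  carrier matter.\<close>

definition linear_on :: "'a::real_vector set \<Rightarrow> ('a \<Rightarrow> 'b::real_vector) \<Rightarrow> bool" where
  "linear_on E T \<longleftrightarrow>
     (\<forall>x\<in>E. \<forall>y\<in>E. T (x + y) = T x + T y) \<and> (\<forall>c. \<forall>x\<in>E. T (c *\<^sub>R x) = c *\<^sub>R T x)"

definition finite_dim_subspace :: "'a::real_vector set \<Rightarrow> bool" where
  "finite_dim_subspace E \<longleftrightarrow> (\<exists>B. finite B \<and> E = span B)"

definition ai_ideal :: "'a::real_normed_vector set \<Rightarrow> bool" where
  "ai_ideal Y \<longleftrightarrow>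
     (\<forall>\<epsilon>>0. \<forall>E::'a set. finite_dim_subspace E \<longrightarrow>
        (\<exists>T::'a \<Rightarrow> 'a. linear_on E T \<and> T ` E \<subseteq> Y \<and>
           (\<forall>e\<in>E \<inter> Y. T e = e) \<and>
           (\<forall>e\<in>E. 1 / (1 + \<epsilon>) * norm e \<le> norm (T e) \<and> norm (T e) \<le> (1 + \<epsilon>) * norm e)))"

definition unit_ball :: "'a::real_normed_vector set \<Rightarrow> 'a set" where
  "unit_ball Y = {x \<in> Y. norm x \<le> 1}"

definition in_dual :: "'a::real_normed_vector set \<Rightarrow> ('a \<Rightarrow> real) \<Rightarrow> bool" where
  "in_dual Y f \<longleftrightarrow> linear_on Y f \<and> (\<exists>K. \<forall>x\<in>Y. \<bar>f x\<bar> \<le> K * norm x)"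

definition dual_norm :: "'a::real_normed_vector set \<Rightarrow> ('a \<Rightarrow> real) \<Rightarrow> real" where
  "dual_norm Y f = (SUP x\<in>unit_ball Y. \<bar>f x\<bar>)"

definition slice :: "'a::real_normed_vector set \<Rightarrow> ('a \<Rightarrow> real) \<Rightarrow> real \<Rightarrow> 'a set" where
  "slice Y f \<alpha> = {x \<in> unit_ball Y. f x > (SUP y\<in>unit_ball Y. f y) - \<alpha>}"

definition BDP :: "'a::real_normed_vector set \<Rightarrow> bool" where
  "BDP Y \<longleftrightarrow>
     (\<forall>\<epsilon>>0. \<exists>f \<alpha>. in_dual Y f \<and> dual_norm Y f = 1 \<and> \<alpha> > 0 \<and> diameter (slice Y f \<alpha>) < \<epsilon>)"

text \<open>On the whole space these are the library's notions.\<close>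

lemma in_dual_UNIV: "in_dual UNIV f \<longleftrightarrow> bounded_linear f"
  unfolding in_dual_def linear_on_def
  by (auto simp: bounded_linear_def bounded_linear_axioms_def linear_iff mult.commute)

lemma dual_norm_UNIV:
  fixes f :: "'a::real_normed_vector \<Rightarrow> real"
  assumes "bounded_linear f"
  shows "dual_norm UNIV f = onorm f"
proof (rule antisym)
  have le: "\<bar>f x\<bar> \<le> onorm f" if "norm x \<le> 1" for x
  proof -
    have "\<bar>f x\<bar> \<le> onorm f * norm x" using onorm[OF assms, of x] by simp
    also have "\<dots> \<le> onorm f * 1" by (intro mult_left_mono that onorm_pos_le assms)
    finally show ?thesis by simp
  qed
  have ne: "unit_ball (UNIV::'a set) \<noteq> {}" by (auto simp: unit_ball_def intro: exI[of _ 0])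
  show "dual_norm UNIV f \<le> onorm f"
    unfolding dual_norm_def using ne by (rule cSUP_least) (simp add: unit_ball_def le)
  have bdd: "bdd_above ((\<lambda>x. \<bar>f x\<bar>) ` unit_ball UNIV)"
    by (rule bdd_aboveI[of _ "onorm f"]) (auto simp: unit_ball_def le)
  have "norm (f x) / norm x \<le> dual_norm UNIV f" for x
  proof -
    have "norm (f x) / norm x = \<bar>f (x /\<^sub>R norm x)\<bar>"
      using assms by (simp add: linear_simps abs_mult divide_inverse mult.commute)
    also have "\<dots> \<le> dual_norm UNIV f"
      unfolding dual_norm_def by (rule cSUP_upper[OF _ bdd]) (cases "x = 0"; simp add: unit_ball_def)
    finally show ?thesis .
  qed
  then show "onorm f \<le> dual_norm UNIV f" unfolding onorm_def by (intro cSUP_least) auto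
qed

end

theory Submission
  imports Defs
begin

text \<open>
  Let \<open>f\<close> be a norm-one functional on \<open>Y\<close> with a slice of small diameter. The near-isometries
  \<open>T : E \<rightarrow> Y\<close> supplied by the ideal property transport \<open>f\<close> to functionals \<open>f \<circ> T\<close> on larger and
  larger finite-dimensional subspaces \<open>E\<close> of \<open>X\<close>. At each point these values are bounded, so by
  Tychonoff's theorem they have a pointwise cluster point \<open>g\<close> (lemma
  \<open>ai_ideal_cluster_functional\<close>). Everything needed about \<open>g\<close> involves only finitely many points
  at a time, where \<open>g\<close> is as close as desired to some \<open>f \<circ> T\<close>. Hence \<open>g\<close> is a linear extension
  of \<open>f\<close> to \<open>X\<close> of the same norm.

  The same slice width \<open>\<alpha>\<close> works for \<open>g\<close>. For two points \<open>x\<close>, \<open>y\<close> of the slice of \<open>g\<close>, choose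
  \<open>T\<close> so close to an isometry, and \<open>f \<circ> T\<close> so close to \<open>g\<close> at \<open>x\<close> and \<open>y\<close>, that \<open>T x\<close> and \<open>T y\<close>,
  divided by \<open>1 + \<delta>\<close> to return to the unit ball, lie in the slice of \<open>f\<close>. Their distance is at
  most the diameter of that slice, and \<open>T\<close> distorts distances by a factor of at most \<open>1 + \<delta>\<close>; letting
  \<open>\<delta>\<close> tend to zero, the slice of \<open>g\<close> has no larger diameter than the slice of \<open>f\<close>.
\<close>

section \<open>Norm-one functionals and their slices\<close>

lemma in_dual_bdd_above:
  assumes "in_dual Y f"
  shows "bdd_above ((\<lambda>x. \<bar>f x\<bar>) ` unit_ball Y)"
proof -
  obtain K where K: "\<And>x. x \<in> Y \<Longrightarrow> \<bar>f x\<bar> \<le> K * norm x"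
    using assms unfolding in_dual_def by blast
  show ?thesis
  proof (rule bdd_aboveI2)
    fix x assume x: "x \<in> unit_ball Y"
    then have "\<bar>f x\<bar> \<le> K * norm x" using K by (simp add: unit_ball_def)
    also have "\<dots> \<le> \<bar>K\<bar> * 1"
      using x by (intro mult_mono) (auto simp: unit_ball_def)
    finally show "\<bar>f x\<bar> \<le> \<bar>K\<bar>" by simp
  qed
qed

lemma abs_le_dual_norm:
  assumes "subspace Y" "in_dual Y f" "y \<in> Y"
  shows "\<bar>f y\<bar> \<le> dual_norm Y f * norm y"
proof (cases "y = 0")
  case True
  obtain K where "\<bar>f y\<bar> \<le> K * norm y" using assms unfolding in_dual_def by blast
  then show ?thesis using True by simp
next
  case False
  have "inverse (norm y) *\<^sub>R y \<in> unit_ball Y"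
    using assms False by (simp add: unit_ball_def subspace_scale)
  then have "\<bar>f (inverse (norm y) *\<^sub>R y)\<bar> \<le> dual_norm Y f"
    unfolding dual_norm_def by (rule cSUP_upper) (rule in_dual_bdd_above[OF assms(2)])
  moreover have "f (inverse (norm y) *\<^sub>R y) = inverse (norm y) * f y"
    using assms by (simp add: in_dual_def linear_on_def)
  ultimately have "inverse (norm y) * \<bar>f y\<bar> \<le> dual_norm Y f"
    by (simp add: abs_mult)
  then show ?thesis
    using False by (simp add: field_simps)
qed

text \<open>The ball is symmetric, so absolute values may be dropped in the supremum: slices of a
  norm-one functional are cut off at height \<open>1 - \<alpha>\<close>.\<close>

lemma SUP_unit_ball_eq_dual_norm:
  assumes "subspace Y" "in_dual Y f"
  shows "(SUP y\<in>unit_ball Y. f y) = dual_norm Y f"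
proof (rule antisym)
  have ne: "unit_ball Y \<noteq> {}"
    using assms(1) by (auto simp: unit_ball_def subspace_0 intro!: exI[of _ 0])
  have bdd: "bdd_above ((\<lambda>x. \<bar>f x\<bar>) ` unit_ball Y)"
    by (rule in_dual_bdd_above[OF assms(2)])
  then have bdd': "bdd_above (f ` unit_ball Y)"
    unfolding bdd_above_def by (auto intro: order_trans[OF abs_ge_self])
  show "(SUP y\<in>unit_ball Y. f y) \<le> dual_norm Y f"
    unfolding dual_norm_def by (rule cSUP_mono[OF ne bdd]) (auto intro: abs_ge_self)
  show "dual_norm Y f \<le> (SUP y\<in>unit_ball Y. f y)"
    unfolding dual_norm_def
  proof (rule cSUP_least[OF ne])
    fix x assume x: "x \<in> unit_ball Y"
    then have "- x \<in> unit_ball Y"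
      using assms(1) by (simp add: unit_ball_def subspace_neg)
    moreover have "f ((-1) *\<^sub>R x) = (-1) *\<^sub>R f x"
      using assms(2) x unfolding in_dual_def linear_on_def unit_ball_def by blast
    ultimately have "f x \<le> (SUP y\<in>unit_ball Y. f y)" "- f x \<le> (SUP y\<in>unit_ball Y. f y)"
      using cSUP_upper[OF x bdd'] cSUP_upper[of "- x", OF _ bdd'] by auto
    then show "\<bar>f x\<bar> \<le> (SUP y\<in>unit_ball Y. f y)" by simp
  qed
qed

lemma slice_eq:
  assumes "subspace Y" "in_dual Y f" "dual_norm Y f = 1"
  shows "slice Y f \<alpha> = {x \<in> Y. norm x \<le> 1 \<and> f x > 1 - \<alpha>}"
  using SUP_unit_ball_eq_dual_norm[OF assms(1,2)] assms(3)
  by (auto simp: slice_def unit_ball_def)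

lemma bounded_slice: "bounded (slice Y f \<alpha>)"
  by (rule boundedI[of _ 1]) (auto simp: slice_def unit_ball_def)

section \<open>Transporting a functional along almost isometries\<close>

definition almost_isometry_into ::
    "'a::real_normed_vector set \<Rightarrow> real \<Rightarrow> 'a set \<Rightarrow> ('a \<Rightarrow> 'a) \<Rightarrow> bool" where
  "almost_isometry_into Y \<delta> E T \<longleftrightarrow>
     linear_on E T \<and> T ` E \<subseteq> Y \<and> (\<forall>e\<in>E \<inter> Y. T e = e) \<and>
     (\<forall>e\<in>E. 1 / (1 + \<delta>) * norm e \<le> norm (T e) \<and> norm (T e) \<le> (1 + \<delta>) * norm e)"

lemma almost_isometry_mono:
  assumes T: "almost_isometry_into Y \<delta> E T" and "E' \<subseteq> E" "0 < \<delta>" "\<delta> \<le> \<delta>'"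
  shows "almost_isometry_into Y \<delta>' E' T"
proof -
  have "1 / (1 + \<delta>') * norm e \<le> norm (T e) \<and> norm (T e) \<le> (1 + \<delta>') * norm e" if "e \<in> E'" for e
  proof -
    have "1 / (1 + \<delta>) * norm e \<le> norm (T e)" "norm (T e) \<le> (1 + \<delta>) * norm e"
      using T that assms(2) unfolding almost_isometry_into_def by blast+
    moreover have "1 / (1 + \<delta>') * norm e \<le> 1 / (1 + \<delta>) * norm e"
      using assms by (intro mult_right_mono divide_left_mono) auto
    moreover have "(1 + \<delta>) * norm e \<le> (1 + \<delta>') * norm e"
      using assms by (intro mult_right_mono) auto
    ultimately show ?thesis by linarith
  qed
  then show ?thesis
    using T assms(2) unfolding almost_isometry_into_def linear_on_def by blast
qed

text \<open>This is Tychonoff's theorem for families of real functions, in terms of filters: such a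
  family has a pointwise cluster point as soon as it is eventually pointwise bounded.\<close>

lemma pointwise_cluster_point:
  fixes G :: "'i \<Rightarrow> 'a \<Rightarrow> real"
  assumes "F \<noteq> bot" and bound: "eventually (\<lambda>i. \<forall>x. \<bar>G i x\<bar> \<le> M x) F"
  obtains g where "\<And>A \<delta> P. \<lbrakk>finite A; \<delta> > 0; eventually P F\<rbrakk>
                     \<Longrightarrow> \<exists>i. P i \<and> (\<forall>x\<in>A. \<bar>G i x - g x\<bar> < \<delta>)"
proof -
  define S where "S = Pi\<^sub>E UNIV (\<lambda>x. {- M x .. M x})"
  have "compactin (product_topology (\<lambda>i. euclidean) UNIV) S"
    unfolding S_def by (subst compactin_PiE) auto
  then have "compact S"
    by (simp add: euclidean_product_topology)
  moreover have "eventually (\<lambda>h. h \<in> S) (filtermap G F)"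
    unfolding eventually_filtermap using bound
  proof eventually_elim
    case (elim i)
    have "G i x \<in> {- M x .. M x}" for x using elim[rule_format, of x] by auto
    then show ?case by (simp add: S_def PiE_UNIV_domain)
  qed
  moreover have "filtermap G F \<noteq> bot" using assms(1) by (simp add: filtermap_bot_iff)
  ultimately obtain g where g: "inf (nhds g) (filtermap G F) \<noteq> bot"
    unfolding compact_filter by blast
  show thesis
  proof (rule that[of g])
    fix A :: "'a set" and \<delta> :: real and P assume A: "finite A" "\<delta> > 0" and P: "eventually P F"
    define U where "U = (\<Inter>x\<in>A. (\<lambda>h. h x) -` ball (g x) \<delta>)"
    have "open U" unfolding U_def using A
      by (intro open_INT ballI open_vimage continuous_on_product_coordinates) auto
    moreover have "g \<in> U" using A by (simp add: U_def)
    ultimately have U: "eventually (\<lambda>h. h \<in> U) (nhds g)" by (rule eventually_nhds_in_open)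
    show "\<exists>i. P i \<and> (\<forall>x\<in>A. \<bar>G i x - g x\<bar> < \<delta>)"
    proof (rule ccontr)
      assume no: "\<nexists>i. P i \<and> (\<forall>x\<in>A. \<bar>G i x - g x\<bar> < \<delta>)"
      have "eventually (\<lambda>h. h \<notin> U) (filtermap G F)"
        unfolding eventually_filtermap using P
      proof eventually_elim
        case (elim i)
        then show ?case using no by (auto simp: U_def dist_real_def abs_minus_commute)
      qed
      with U have "eventually (\<lambda>_. False) (inf (nhds g) (filtermap G F))"
        unfolding eventually_inf by blast
      with g show False by (simp add: trivial_limit_def)
    qed
  qed
qed

text \<open>These are the cluster points, in the topology of pointwise convergence, of the functions
  \<open>f \<circ> T\<close> as the domain of \<open>T\<close> grows and its tolerance shrinks. One \<open>\<delta>\<close> serves for the tolerance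
  and for the error of approximation, since both can be made arbitrarily small together.\<close>

definition ai_approximable :: "'a::real_normed_vector set \<Rightarrow> ('a \<Rightarrow> real) \<Rightarrow> ('a \<Rightarrow> real) \<Rightarrow> bool" where
  "ai_approximable Y f g \<longleftrightarrow>
     (\<forall>A \<delta>. finite A \<longrightarrow> \<delta> > 0 \<longrightarrow>
        (\<exists>T. almost_isometry_into Y \<delta> (span A) T \<and> (\<forall>x\<in>A. \<bar>f (T x) - g x\<bar> < \<delta>)))"

text \<open>An almost isometry on a larger subspace with a smaller tolerance restricts to one on a smaller
  subspace. Choosing one for every finite spanning set and tolerance therefore gives a net, and
  each cluster point of the transported functionals serves all subspaces at once. Outside the
  span the transported functional is set to zero, which keeps it bounded pointwise.\<close>

lemma ai_ideal_cluster_functional: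
  fixes Y :: "'a::real_normed_vector set"
  assumes ai: "ai_ideal Y" and f: "\<And>y. y \<in> Y \<Longrightarrow> \<bar>f y\<bar> \<le> K * norm y"
  obtains g where "ai_approximable Y f g"
proof -
  have "\<exists>T. almost_isometry_into Y \<delta> (span B) T" if "finite B" "\<delta> > 0" for B \<delta>
  proof -
    have "finite_dim_subspace (span B)"
      using that(1) unfolding finite_dim_subspace_def by blast
    with ai that(2) show ?thesis
      unfolding ai_ideal_def almost_isometry_into_def by simp
  qed
  then obtain T where T: "\<And>B \<delta>. \<lbrakk>finite B; \<delta> > 0\<rbrakk> \<Longrightarrow> almost_isometry_into Y \<delta> (span B) (T B \<delta>)"
    by metis
  \<comment> \<open>The pairs \<open>(B, \<delta>)\<close> run along growing finite sets and shrinking tolerances.\<close>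
  define F where "F = finite_subsets_at_top (UNIV :: 'a set) \<times>\<^sub>F at_right (0::real)"
  define G where "G = (\<lambda>(B, \<delta>) x. if x \<in> span B then f (T B \<delta> x) else 0)"
  have ev: "eventually (\<lambda>(B, \<delta>). finite B \<and> A \<subseteq> B \<and> 0 < \<delta> \<and> \<delta> < d) F" if "finite A" "d > 0" for A d
    unfolding F_def eventually_prod_filter
  proof (intro exI conjI)
    show "eventually (\<lambda>B. finite B \<and> A \<subseteq> B) (finite_subsets_at_top UNIV)"
      using that unfolding eventually_finite_subsets_at_top by blast
    show "eventually (\<lambda>\<delta>. 0 < \<delta> \<and> \<delta> < d) (at_right (0::real))"
      using that unfolding eventually_at_right_field by blast
  qed auto
  have "F \<noteq> bot" by (simp add: F_def prod_filter_eq_bot)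
  moreover have "eventually (\<lambda>i. \<forall>x. \<bar>G i x\<bar> \<le> \<bar>K\<bar> * (2 * norm x)) F"
    using ev[of "{}" 1, simplified]
  proof eventually_elim
    case (elim i)
    obtain B \<delta> where i: "i = (B, \<delta>)" and B: "finite B" "0 < \<delta>" "\<delta> < 1"
      using elim by (cases i) auto
    have "\<bar>f (T B \<delta> x)\<bar> \<le> \<bar>K\<bar> * (2 * norm x)" if x: "x \<in> span B" for x
    proof -
      have TY: "T B \<delta> x \<in> Y" and n: "norm (T B \<delta> x) \<le> (1 + \<delta>) * norm x"
        using T[OF B(1,2)] x unfolding almost_isometry_into_def by blast+
      have "(1 + \<delta>) * norm x \<le> 2 * norm x" using B by (intro mult_right_mono) auto
      with n have "K * norm (T B \<delta> x) \<le> \<bar>K\<bar> * (2 * norm x)"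
        by (intro mult_mono) auto
      then show ?thesis using f[OF TY] by linarith
    qed
    then show ?case by (auto simp: i G_def)
  qed
  ultimately obtain g where g: "\<And>A \<delta> P. \<lbrakk>finite A; \<delta> > 0; eventually P F\<rbrakk>
                     \<Longrightarrow> \<exists>i. P i \<and> (\<forall>x\<in>A. \<bar>G i x - g x\<bar> < \<delta>)"
    by (rule pointwise_cluster_point) (rule that)
  show thesis
  proof (rule that[of g], unfold ai_approximable_def, intro allI impI)
    fix A :: "'a set" and \<delta> :: real assume A: "finite A" "\<delta> > 0"
    obtain B d where B: "finite B" "A \<subseteq> B" "0 < d" "d < \<delta>"
      and close: "\<And>x. x \<in> A \<Longrightarrow> \<bar>G (B, d) x - g x\<bar> < \<delta>"
      using g[OF A ev[OF A]] by auto
    have "almost_isometry_into Y \<delta> (span A) (T B d)"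
      using almost_isometry_mono[OF T[OF B(1,3)] span_mono[OF B(2)]] B by simp
    moreover have "\<bar>f (T B d x) - g x\<bar> < \<delta>" if "x \<in> A" for x
      using close[OF that] span_base[of x B] B(2) that by (auto simp: G_def)
    ultimately show "\<exists>T. almost_isometry_into Y \<delta> (span A) T \<and> (\<forall>x\<in>A. \<bar>f (T x) - g x\<bar> < \<delta>)"
      by blast
  qed
qed

section \<open>The cluster functional as a norm-preserving extension\<close>

lemma ai_approximableE:
  assumes "ai_approximable Y f g" "finite A" "\<delta> > 0"
  obtains T where "linear_on (span A) T" "\<And>x. x \<in> span A \<Longrightarrow> T x \<in> Y"
    "\<And>x. x \<in> span A \<Longrightarrow> x \<in> Y \<Longrightarrow> T x = x"
    "\<And>x. x \<in> span A \<Longrightarrow> norm x \<le> (1 + \<delta>) * norm (T x)"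
    "\<And>x. x \<in> span A \<Longrightarrow> norm (T x) \<le> (1 + \<delta>) * norm x"
    "\<And>x. x \<in> A \<Longrightarrow> \<bar>f (T x) - g x\<bar> < \<delta>"
proof -
  obtain T where T: "almost_isometry_into Y \<delta> (span A) T" "\<forall>x\<in>A. \<bar>f (T x) - g x\<bar> < \<delta>"
    using assms unfolding ai_approximable_def by blast
  have "norm x \<le> (1 + \<delta>) * norm (T x)" if "x \<in> span A" for x
  proof -
    have "1 / (1 + \<delta>) * norm x \<le> norm (T x)"
      using T(1) that unfolding almost_isometry_into_def by blast
    then show ?thesis using assms(3) by (simp add: field_simps)
  qed
  then show thesis
    using T that[of T] unfolding almost_isometry_into_def by blast
qed

lemma ai_approximable_extends:
  assumes g: "ai_approximable Y f g" and y: "y \<in> Y"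
  shows "g y = f y"
proof -
  have "\<bar>f y - g y\<bar> < \<delta>" if \<delta>: "\<delta> > 0" for \<delta>
  proof -
    obtain T where "T y = y" "\<bar>f (T y) - g y\<bar> < \<delta>"
      by (rule ai_approximableE[OF g, of "{y}" \<delta>]) (use \<delta> y in \<open>auto simp: span_base\<close>)
    then show ?thesis by simp
  qed
  from this[of "\<bar>f y - g y\<bar>"] show ?thesis by fastforce
qed

lemma ai_approximable_bound:
  assumes g: "ai_approximable Y f g" and f: "\<And>y. y \<in> Y \<Longrightarrow> \<bar>f y\<bar> \<le> norm y"
  shows "\<bar>g x\<bar> \<le> norm x"
proof (rule field_le_epsilon)
  fix e :: real assume e: "e > 0"
  \<comment> \<open>Replacing \<open>g x\<close> by \<open>f (T x)\<close> costs \<open>\<delta>\<close>, and \<open>T\<close> may stretch \<open>x\<close> by \<open>\<delta> * norm x\<close>.\<close>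
  define \<delta> where "\<delta> = e / (1 + norm x)"
  have n0: "1 + norm x > 0" by (simp add: add_pos_nonneg)
  have "\<delta> * (1 + norm x) = e" using n0 by (simp add: \<delta>_def)
  then have \<delta>: "\<delta> > 0" "\<delta> + \<delta> * norm x = e"
    using e n0 by (simp_all add: \<delta>_def distrib_left)
  obtain T where "\<And>z. z \<in> span {x} \<Longrightarrow> T z \<in> Y"
    "\<And>z. z \<in> span {x} \<Longrightarrow> norm (T z) \<le> (1 + \<delta>) * norm z" "\<bar>f (T x) - g x\<bar> < \<delta>"
    by (rule ai_approximableE[OF g, of "{x}" \<delta>]) (use \<delta>(1) in auto)
  then have T: "T x \<in> Y" "norm (T x) \<le> (1 + \<delta>) * norm x" "\<bar>f (T x) - g x\<bar> < \<delta>"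
    by (simp_all add: span_base)
  have "\<bar>g x\<bar> \<le> norm (T x) + \<delta>" using f[OF T(1)] T(3) by linarith
  also have "\<dots> \<le> norm x + e" using T(2) \<delta>(2) by (simp add: algebra_simps)
  finally show "\<bar>g x\<bar> \<le> norm x + e" .
qed

lemma ai_approximable_linear:
  assumes g: "ai_approximable Y f g" and f: "linear_on Y f"
  shows "linear_on UNIV g"
  unfolding linear_on_def
proof (intro conjI ballI allI)
  fix x y
  have "\<bar>g (x + y) - (g x + g y)\<bar> < e" if e: "e > 0" for e
  proof -
    obtain T where T: "linear_on (span {x, y, x + y}) T" "T x \<in> Y" "T y \<in> Y"
      "\<bar>f (T x) - g x\<bar> < e/3" "\<bar>f (T y) - g y\<bar> < e/3" "\<bar>f (T (x + y)) - g (x + y)\<bar> < e/3"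
      by (rule ai_approximableE[OF g, of "{x, y, x + y}" "e/3"]) (use e in \<open>auto simp: span_base\<close>)
    have "T (x + y) = T x + T y"
      using T(1) unfolding linear_on_def by (simp add: span_base)
    then have "f (T (x + y)) = f (T x) + f (T y)"
      using f T(2,3) by (simp add: linear_on_def)
    then show ?thesis using T(4-6) by linarith
  qed
  from this[of "\<bar>g (x + y) - (g x + g y)\<bar>"] show "g (x + y) = g x + g y" by fastforce
next
  fix c :: real and x
  have "\<bar>g (c *\<^sub>R x) - c * g x\<bar> < e" if e: "e > 0" for e
  proof -
    \<comment> \<open>The error at \<open>x\<close>, amplified by \<open>\<bar>c\<bar>\<close>, and the error at \<open>c *\<^sub>R x\<close> then sum to less than \<open>e\<close>.\<close>
    define \<delta> where "\<delta> = e / (1 + \<bar>c\<bar>)"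
    have c0: "1 + \<bar>c\<bar> > 0" by (simp add: add_pos_nonneg)
    then have "\<delta> * (1 + \<bar>c\<bar>) = e" by (simp add: \<delta>_def)
    then have \<delta>: "\<delta> > 0" "\<delta> + \<bar>c\<bar> * \<delta> = e"
      using e c0 by (simp add: \<delta>_def, simp add: algebra_simps)
    obtain T where T: "linear_on (span {x, c *\<^sub>R x}) T" "T x \<in> Y"
      "\<bar>f (T x) - g x\<bar> < \<delta>" "\<bar>f (T (c *\<^sub>R x)) - g (c *\<^sub>R x)\<bar> < \<delta>"
      by (rule ai_approximableE[OF g, of "{x, c *\<^sub>R x}" \<delta>]) (use \<delta>(1) in \<open>auto simp: span_base\<close>)
    have "T (c *\<^sub>R x) = c *\<^sub>R T x"
      using T(1) unfolding linear_on_def by (simp add: span_base)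
    then have fT: "f (T (c *\<^sub>R x)) = c * f (T x)"
      using f T(2) by (simp add: linear_on_def)
    have "\<bar>c * f (T x) - c * g x\<bar> = \<bar>c\<bar> * \<bar>f (T x) - g x\<bar>"
      by (simp add: abs_mult flip: right_diff_distrib)
    also have "\<dots> \<le> \<bar>c\<bar> * \<delta>" using T(3) by (intro mult_left_mono) auto
    finally show ?thesis using T(4) \<delta>(2) fT by linarith
  qed
  from this[of "\<bar>g (c *\<^sub>R x) - c * g x\<bar>"] show "g (c *\<^sub>R x) = c *\<^sub>R g x" by fastforce
qed

lemma ai_approximable_dual:
  assumes Y: "subspace Y" and g: "ai_approximable Y f g"
    and f: "in_dual Y f" "dual_norm Y f = 1"
  shows "in_dual UNIV g" "dual_norm UNIV g = 1"
proof -
  have bound: "\<bar>g x\<bar> \<le> norm x" for x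
    using ai_approximable_bound[OF g] abs_le_dual_norm[OF Y f(1)] f(2) by simp
  show dual: "in_dual UNIV g"
    unfolding in_dual_def using ai_approximable_linear[OF g] f(1) bound
    by (auto simp: in_dual_def intro: exI[of _ 1])
  show "dual_norm UNIV g = 1"
  proof (rule antisym)
    show "dual_norm UNIV g \<le> 1"
      unfolding dual_norm_def
      by (rule cSUP_least) (auto simp: unit_ball_def intro: order_trans[OF bound] exI[of _ 0])
    have "dual_norm Y f \<le> dual_norm UNIV g"
      unfolding dual_norm_def
    proof (rule cSUP_mono[OF _ in_dual_bdd_above[OF dual]])
      show "unit_ball Y \<noteq> {}"
        using Y by (auto simp: unit_ball_def subspace_0 intro!: exI[of _ 0])
      show "\<exists>z\<in>unit_ball UNIV. \<bar>f y\<bar> \<le> \<bar>g z\<bar>" if "y \<in> unit_ball Y" for y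
        using that ai_approximable_extends[OF g] by (intro bexI[of _ y]) (auto simp: unit_ball_def)
    qed
    then show "1 \<le> dual_norm UNIV g" using f(2) by simp
  qed
qed

section \<open>Slices of the extension are no larger\<close>

text \<open>With \<open>c = 1 / (1 + \<delta>)\<close>, the points \<open>c *\<^sub>R T x\<close> and \<open>c *\<^sub>R T y\<close> of \<open>Y\<close> lie in the slice of \<open>f\<close>
  as soon as \<open>\<delta>\<close> is at most half the margin by which \<open>g x\<close> and \<open>g y\<close> exceed \<open>1 - \<alpha>\<close>: one half
  pays for replacing \<open>g\<close> by \<open>f \<circ> T\<close>, the other for the rescaling. Going to \<open>Y\<close> and back costs a
  factor \<open>(1 + \<delta>)\<^sup>2\<close>, which disappears in the limit.\<close>

lemma norm_diff_le_diameter_slice: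
  assumes Y: "subspace Y" and g: "ai_approximable Y f g"
    and f: "in_dual Y f" "dual_norm Y f = 1"
    and x: "norm x \<le> 1" "g x > 1 - \<alpha>" and y: "norm y \<le> 1" "g y > 1 - \<alpha>"
  shows "norm (x - y) \<le> diameter (slice Y f \<alpha>)"
proof -
  define D where "D = diameter (slice Y f \<alpha>)"
  have est: "norm (x - y) \<le> (1 + \<delta>) * ((1 + \<delta>) * D)"
    if \<delta>: "0 < \<delta>" "\<delta> \<le> (g x - (1 - \<alpha>)) / 2" "\<delta> \<le> (g y - (1 - \<alpha>)) / 2" for \<delta>
  proof -
    obtain T where lin: "linear_on (span {x, y}) T"
      and TY: "\<And>z. z \<in> span {x, y} \<Longrightarrow> T z \<in> Y"
      and lower: "\<And>z. z \<in> span {x, y} \<Longrightarrow> norm z \<le> (1 + \<delta>) * norm (T z)"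
      and upper: "\<And>z. z \<in> span {x, y} \<Longrightarrow> norm (T z) \<le> (1 + \<delta>) * norm z"
      and close: "\<And>z. z \<in> {x, y} \<Longrightarrow> \<bar>f (T z) - g z\<bar> < \<delta>"
      by (rule ai_approximableE[OF g, of "{x, y}" \<delta>]) (use \<delta> in auto)
    define c where "c = inverse (1 + \<delta>)"
    have c: "0 < c" "c * (1 + \<delta>) = 1" using \<delta> by (simp_all add: c_def)
    have slice: "c *\<^sub>R T z \<in> slice Y f \<alpha>"
      if z: "z \<in> {x, y}" "norm z \<le> 1" "\<delta> \<le> (g z - (1 - \<alpha>)) / 2" for z
    proof -
      have zs: "z \<in> span {x, y}" using z by (simp add: span_base)
      have nT: "norm (T z) \<le> 1 + \<delta>"
        using upper[OF zs] mult_left_le[OF z(2), of "1 + \<delta>"] \<delta> by linarith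
      have n: "norm (c *\<^sub>R T z) \<le> 1"
        using mult_left_mono[OF nT, of c] c by simp
      have cY: "c *\<^sub>R T z \<in> Y" using TY[OF zs] Y by (simp add: subspace_scale)
      have fc: "f (c *\<^sub>R T z) = c * f (T z)"
        using f(1) TY[OF zs] by (simp add: in_dual_def linear_on_def)
      have fn: "f (c *\<^sub>R T z) \<le> 1"
        using abs_le_dual_norm[OF Y f(1) cY] f(2) n by simp
      \<comment> \<open>Rescaling costs at most \<open>\<delta>\<close>, since \<open>T z - c *\<^sub>R T z = \<delta> *\<^sub>R (c *\<^sub>R T z)\<close>
          and \<open>c *\<^sub>R T z\<close> lies in the unit ball.\<close>
      have "f (T z) = f (c *\<^sub>R T z) * (1 + \<delta>)"
        using c by (simp add: fc mult.commute mult.left_commute)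
      also have "\<dots> \<le> f (c *\<^sub>R T z) + \<delta>"
        using mult_left_mono[OF fn, of \<delta>] \<delta> by (simp add: algebra_simps)
      finally have "f (c *\<^sub>R T z) > 1 - \<alpha>"
        using abs_less_iff[THEN iffD1, OF close[OF z(1)]] z(3) by (simp add: field_simps)
      then show ?thesis using cY n by (simp add: slice_eq[OF Y f])
    qed
    have "x \<in> span {x, y}" "y \<in> span {x, y}" "(-1) *\<^sub>R y \<in> span {x, y}"
      by (simp_all add: span_base span_neg)
    then have "T (x + (-1) *\<^sub>R y) = T x + T ((-1) *\<^sub>R y)" "T ((-1) *\<^sub>R y) = (-1) *\<^sub>R T y"
      using lin unfolding linear_on_def by blast+
    then have Tdiff: "T (x - y) = T x - T y" by simp
    have "dist (c *\<^sub>R T x) (c *\<^sub>R T y) \<le> D"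
      unfolding D_def using slice x y \<delta>
      by (intro diameter_bounded_bound bounded_slice) auto
    then have "c * norm (T (x - y)) \<le> D"
      using c(1) by (simp add: dist_norm Tdiff flip: scaleR_diff_right)
    then have "norm (T (x - y)) \<le> (1 + \<delta>) * D"
      using \<delta> by (simp add: c_def field_simps)
    then have "(1 + \<delta>) * norm (T (x - y)) \<le> (1 + \<delta>) * ((1 + \<delta>) * D)"
      using \<delta> by (intro mult_left_mono) auto
    moreover have "norm (x - y) \<le> (1 + \<delta>) * norm (T (x - y))"
      by (rule lower) (simp add: span_base span_diff)
    ultimately show ?thesis by linarith
  qed
  define d where "d = min ((g x - (1 - \<alpha>)) / 2) ((g y - (1 - \<alpha>)) / 2)"
  have "d > 0" using x y by (simp add: d_def)
  then have "eventually (\<lambda>\<delta>. 0 < \<delta> \<and> \<delta> < d) (at_right 0)"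
    unfolding eventually_at_right_field by blast
  then have "eventually (\<lambda>\<delta>. norm (x - y) \<le> (1 + \<delta>) * ((1 + \<delta>) * D)) (at_right 0)"
    by eventually_elim (rule est; simp add: d_def)
  moreover have "((\<lambda>\<delta>. (1 + \<delta>) * ((1 + \<delta>) * D)) \<longlongrightarrow> (1 + 0) * ((1 + 0) * D)) (at_right (0::real))"
    by (intro tendsto_intros)
  ultimately have "norm (x - y) \<le> (1 + 0) * ((1 + 0) * D)"
    by (intro tendsto_lowerbound) auto
  then show ?thesis by (simp add: D_def)
qed

theorem corollary2p14:
  fixes Y :: "'a::banach set"
  assumes "\<exists>x::'a. x \<noteq> 0"
    and "subspace Y" and "closed Y" and "Y \<noteq> {0}"
    and "ai_ideal Y"
    and "BDP Y"
  shows "BDP (UNIV :: 'a set)"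
  unfolding BDP_def
proof (intro allI impI)
  fix \<epsilon> :: real assume "\<epsilon> > 0"
  then obtain f \<alpha> where f: "in_dual Y f" "dual_norm Y f = 1" and \<alpha>: "\<alpha> > 0"
    and small: "diameter (slice Y f \<alpha>) < \<epsilon>"
    using assms(6) unfolding BDP_def by blast
  obtain g where g: "ai_approximable Y f g"
    using ai_ideal_cluster_functional[OF assms(5) abs_le_dual_norm[OF assms(2) f(1)]] by blast
  have dual: "in_dual UNIV g" "dual_norm UNIV g = 1"
    by (rule ai_approximable_dual[OF assms(2) g f])+
  have "diameter (slice UNIV g \<alpha>) \<le> diameter (slice Y f \<alpha>)"
  proof (rule diameter_le)
    show "slice UNIV g \<alpha> \<noteq> {} \<or> 0 \<le> diameter (slice Y f \<alpha>)"
      by (simp add: diameter_ge_0 bounded_slice)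
    show "norm (x - y) \<le> diameter (slice Y f \<alpha>)"
      if "x \<in> slice UNIV g \<alpha>" "y \<in> slice UNIV g \<alpha>" for x y
      using that norm_diff_le_diameter_slice[OF assms(2) g f]
      by (simp add: slice_eq[OF subspace_UNIV dual])
  qed
  then show "\<exists>f \<alpha>. in_dual UNIV f \<and> dual_norm UNIV f = 1 \<and> \<alpha> > 0 \<and>
               diameter (slice (UNIV :: 'a set) f \<alpha>) < \<epsilon>"
    using dual \<alpha> small by (intro exI[of _ g] exI[of _ \<alpha>]) auto
qed

end
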